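(* Let $d\ge 2$ be an integer. The axisymmetric Euler flow in $\mathbb{R}^d$, described by the initial value problem $$m_t+u\,m_x+\frac{d-3}{d-1}\,u_x\,m=0,\qquad m:=-\partial_x^2u,\qquad u(0,\cdot)=u_0,\quad u_0\in\hat C^\infty(\mathbb{S}^1),$$ cannot be realized as an Euler equation for any regular inertia operator $A\in\mathcal{L}^{sym}_{is}(\hat C^\infty(\mathbb{S}^1))$ of Fourier type. That is, there is no such $A$ with $$A^{-1}\big[2(Au)u_x+u(Au)_x\big]=(-\partial_x^2)^{-1}\Big[\tfrac{d-3}{d-1}\,(-u_{xx})\,u_x+u\,(-u_{xx})_x\Big]\quad\text{for all }u\in\hat C^\infty(\mathbb{S}^1).$$
   Context: $\mathbb{S}^1=\mathbb{R}/\mathbb{Z}$. $\hat C^\infty(\mathbb{S}^1)$ is the space of smooth real functions $u$ on $\mathbb{S}^1$ with $\int_{\mathbb{S}^1}u\,dx=0$; $-\partial_x^2$ is an isomorphism of this space. $\mathcal{L}^{sym}_{is}(\hat C^\infty(\mathbb{S}^1))$ is the set of continuous linear isomorphisms of $\hat C^\infty(\mathbb{S}^1)$ onto itself that are symmetric with respect to the $L_2(\mathbb{S}^1)$ inner product (regular inertia operators). Such an $A$ is of Fourier type if it is a Fourier multiplication operator, i.e. (after complex-linear extension) $A e^{2\pi ikx}=\beta_k e^{2\pi ikx}$ for all $k\in\mathbb{Z}\setminus\{0\}$. The space $\hat C^\infty(\mathbb{S}^1)$ represents the Lie algebra of $\mathrm{Diff}^\infty_0(\mathbb{S}^1)=\{\varphi\in\mathrm{Diff}^\infty(\mathbb{S}^1):\varphi(x_0)=x_0\}$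 ($x_0$ fixed), which is identified with the group $\mathrm{Diff}^\infty(\mathbb{S}^1)$ of smooth orientation-preserving diffeomorphisms of the circle modulo rotations. The Euler equation with respect to the right-invariant metric $\rho_A$ induced by $A$ (given at the identity by $\int(Au)v\,dx$) is $u_t=-A^{-1}[2(Au)u_x+u(Au)_x]$. An equation for $m$ is realized as this Euler equation if, when it is solved for $u_t$, its right-hand side agrees with that of the Euler equation for all $u\in\hat C^\infty(\mathbb{S}^1)$. *)

theory Defs
  imports "HOL-Analysis.Analysis"
begin

text \<open>Functions on the circle \<open>\<real>/\<int>\<close> are represented by 1-periodic functions on \<open>\<real>\<close>.\<close>

definition smooth :: "(real \<Rightarrow> real) \<Rightarrow> bool" where
  "smooth u \<longleftrightarrow> (\<forall>n x. (deriv ^^ n) u differentiable (at x))"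

definition Chat :: "(real \<Rightarrow> real) set" where
  "Chat = {u. smooth u \<and> (\<forall>x. u (x + 1) = u x) \<and> integral {0..1} u = 0}"

definition Cn_seminorm :: "nat \<Rightarrow> (real \<Rightarrow> real) \<Rightarrow> real" where
  "Cn_seminorm n u = (SUP x\<in>{0..1}. \<bar>(deriv ^^ n) u x\<bar>)"

text \<open>The Frechet topology: the balls of the seminorms \<^const>\<open>Cn_seminorm\<close> form a subbasis.\<close>

definition Chat_topology :: "(real \<Rightarrow> real) topology" where
  "Chat_topology = topology_generated_by
     {{v \<in> Chat. Cn_seminorm n (\<lambda>x. v x - u x) < e} | n u e. u \<in> Chat \<and> 0 < e}"

lemma topspace_Chat_topology: "topspace Chat_topology = Chat"
proof -
  have "u \<in> topspace Chat_topology" if u: "u \<in> Chat" for u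
  proof -
    have "u \<in> {v \<in> Chat. Cn_seminorm 0 (\<lambda>x. v x - u x) < 1}"
      using u by (simp add: Cn_seminorm_def)
    moreover have "{v \<in> Chat. Cn_seminorm 0 (\<lambda>x. v x - u x) < 1} \<in>
        {{v \<in> Chat. Cn_seminorm n (\<lambda>x. v x - w x) < e} | n w e. w \<in> Chat \<and> 0 < e}"
      using u zero_less_one by blast
    ultimately show ?thesis
      unfolding Chat_topology_def topology_generated_by_topspace by (rule UnionI[rotated])
  qed
  moreover have "topspace Chat_topology \<subseteq> Chat"
    unfolding Chat_topology_def topology_generated_by_topspace by blast
  ultimately show ?thesis by blast
qed

text \<open>
  An operator on \<^const>\<open>Chat\<close> is a HOL function whose values outside \<^const>\<open>Chat\<close> are irrelevant.
  Being a homeomorphism of \<^const>\<open>Chat_topology\<close> includes being a bijection of \<^const>\<open>Chat\<close>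
  onto itself.
\<close>

definition linear_on_Chat :: "((real \<Rightarrow> real) \<Rightarrow> (real \<Rightarrow> real)) \<Rightarrow> bool" where
  "linear_on_Chat A \<longleftrightarrow>
     (\<forall>u\<in>Chat. \<forall>v\<in>Chat. A (\<lambda>x. u x + v x) = (\<lambda>x. A u x + A v x)) \<and>
     (\<forall>c. \<forall>u\<in>Chat. A (\<lambda>x. c * u x) = (\<lambda>x. c * A u x))"

definition L2_symmetric :: "((real \<Rightarrow> real) \<Rightarrow> (real \<Rightarrow> real)) \<Rightarrow> bool" where
  "L2_symmetric A \<longleftrightarrow>
     (\<forall>u\<in>Chat. \<forall>v\<in>Chat. integral {0..1} (\<lambda>x. A u x * v x) = integral {0..1} (\<lambda>x. u x * A v x))"

definition regular_inertia_operator :: "((real \<Rightarrow> real) \<Rightarrow> (real \<Rightarrow> real)) \<Rightarrow> bool" where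
  "regular_inertia_operator A \<longleftrightarrow>
     linear_on_Chat A \<and> homeomorphic_map Chat_topology Chat_topology A \<and> L2_symmetric A"

definition complexified ::
  "((real \<Rightarrow> real) \<Rightarrow> (real \<Rightarrow> real)) \<Rightarrow> ((real \<Rightarrow> complex) \<Rightarrow> (real \<Rightarrow> complex))" where
  "complexified A f = (\<lambda>x. of_real (A (\<lambda>y. Re (f y)) x) + \<i> * of_real (A (\<lambda>y. Im (f y)) x))"

definition fourier_mode :: "int \<Rightarrow> real \<Rightarrow> complex" where
  "fourier_mode k x = exp (2 * of_real pi * \<i> * of_int k * of_real x)"

definition fourier_type :: "((real \<Rightarrow> real) \<Rightarrow> (real \<Rightarrow> real)) \<Rightarrow> bool" where
  "fourier_type A \<longleftrightarrow>
     (\<exists>\<beta> :: int \<Rightarrow> complex. \<forall>k. k \<noteq> 0 \<longrightarrow>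
        complexified A (fourier_mode k) = (\<lambda>x. \<beta> k * fourier_mode k x))"

text \<open>
  Right-hand side of the Euler equation
  \<open>u\<^sub>t = - A\<^sup>-\<^sup>1 [2 (A u) u\<^sub>x + u (A u)\<^sub>x]\<close> of the right-invariant metric induced by \<open>A\<close>.
  If \<open>A\<close> is a regular inertia operator of Fourier type, it commutes with \<open>\<partial>\<^sub>x\<close>, so
  the bracket has mean zero and the inverse is applied to an element of \<^const>\<open>Chat\<close>.
\<close>

definition euler_rhs ::
  "((real \<Rightarrow> real) \<Rightarrow> (real \<Rightarrow> real)) \<Rightarrow> (real \<Rightarrow> real) \<Rightarrow> (real \<Rightarrow> real)" where
  "euler_rhs A u = (\<lambda>x. - inv_into Chat A
     (\<lambda>y. 2 * A u y * deriv u y + u y * deriv (A u) y) x)"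

definition neg_dxx :: "(real \<Rightarrow> real) \<Rightarrow> (real \<Rightarrow> real)" where
  "neg_dxx u = (\<lambda>x. - deriv (deriv u) x)"

text \<open>
  Right-hand side of the axisymmetric Euler flow
  \<open>m\<^sub>t + u m\<^sub>x + (d - 3)/(d - 1) u\<^sub>x m = 0\<close>, \<open>m = - u\<^sub>x\<^sub>x\<close>, solved for \<open>u\<^sub>t\<close>.
  The bracket has mean zero since \<open>m u\<^sub>x = - (u\<^sub>x\<^sup>2)\<^sub>x / 2\<close>.
\<close>

definition axisymmetric_rhs :: "nat \<Rightarrow> (real \<Rightarrow> real) \<Rightarrow> (real \<Rightarrow> real)" where
  "axisymmetric_rhs d u = (\<lambda>x. - inv_into Chat neg_dxx
     (\<lambda>y. (real d - 3) / (real d - 1) * neg_dxx u y * deriv u y + u y * deriv (neg_dxx u) y) x)"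

text \<open>
  An evolution equation \<open>u\<^sub>t = F u\<close> on \<^const>\<open>Chat\<close> is realized as the Euler equation
  of \<open>A\<close> when the two right-hand sides agree.
\<close>

definition realized_as_euler ::
  "((real \<Rightarrow> real) \<Rightarrow> (real \<Rightarrow> real)) \<Rightarrow> ((real \<Rightarrow> real) \<Rightarrow> (real \<Rightarrow> real)) \<Rightarrow> bool" where
  "realized_as_euler F A \<longleftrightarrow> (\<forall>u\<in>Chat. F u = euler_rhs A u)"

end

theory Submission imports Defs begin

text \<open>
  Write \<open>\<beta>\<^sub>k\<close> for the symbol of \<open>A\<close>; it is real because \<open>A\<close> is symmetric, and even because
  \<open>A\<close> is real. Polarizing the equality of the two right-hand sides at the modes \<open>2\<close> and \<open>-1\<close>
  and comparing coefficients of the mode \<open>1\<close>, the unknown \<open>\<beta>\<^sub>2\<close> cancels and \<open>\<beta>\<^sub>1\<close> drops out: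
  with \<open>c = (d - 3)/(d - 1)\<close> one gets \<open>3 = 7 - 2 c\<close>. But \<open>c < 1\<close>. In real terms it suffices
  to test with \<open>u = cos (2 \<pi> x) + cos (4 \<pi> x)\<close>.
\<close>

section \<open>Smooth functions and the vector space structure of \<open>Chat\<close>\<close>

lemma smooth_add:
  assumes "smooth f" "smooth g"
  shows "smooth (\<lambda>x. f x + g x)"
proof -
  have "(deriv ^^ n) (\<lambda>x. f x + g x) = (\<lambda>x. (deriv ^^ n) f x + (deriv ^^ n) g x)" for n
  proof (induction n)
    case (Suc n)
    have "deriv (\<lambda>x. (deriv ^^ n) f x + (deriv ^^ n) g x) x
        = deriv ((deriv ^^ n) f) x + deriv ((deriv ^^ n) g) x" for x
      using assms by (intro deriv_add) (auto simp: smooth_def field_differentiable_def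
        real_differentiable_def)
    with Suc show ?case by auto
  qed simp
  with assms show ?thesis by (auto simp: smooth_def intro: differentiable_add)
qed

lemma smooth_cmult:
  assumes "smooth f"
  shows "smooth (\<lambda>x. c * f x)"
proof -
  have "(deriv ^^ n) (\<lambda>x. c * f x) = (\<lambda>x. c * (deriv ^^ n) f x)" for n
  proof (induction n)
    case (Suc n)
    have "deriv (\<lambda>x. c * (deriv ^^ n) f x) x = c * deriv ((deriv ^^ n) f) x" for x
      using assms by (intro deriv_cmult) (auto simp: smooth_def field_differentiable_def
        real_differentiable_def)
    with Suc show ?case by auto
  qed simp
  with assms show ?thesis by (auto simp: smooth_def intro!: differentiable_mult)
qed

text \<open>Differentiation multiplies by \<open>r\<close> and shifts the phase by
  \<open>pi / 2\<close>, so phase-shifted sines form a family closed under \<open>deriv\<close>. A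
  single induction then serves sine (\<open>s = 0\<close>) and cosine
  (\<open>s = pi / 2\<close>).\<close>

lemma smooth_sin_affine: "smooth (\<lambda>x. sin (r * x + s))"
proof -
  have "(deriv ^^ n) (\<lambda>x. sin (r * x + s)) = (\<lambda>x. r ^ n * sin (r * x + (s + n * (pi / 2))))" for n
  proof (induction n)
    case (Suc n)
    have "deriv (\<lambda>x. r ^ n * sin (r * x + (s + n * (pi / 2)))) x
        = r ^ Suc n * sin (r * x + (s + Suc n * (pi / 2)))" for x
    proof (rule DERIV_imp_deriv)
      have "sin (r * x + (s + Suc n * (pi / 2))) = sin ((r * x + (s + n * (pi / 2))) + pi / 2)"
        by (rule arg_cong[of _ _ sin]) (simp add: algebra_simps add_divide_distrib)
      also have "\<dots> = cos (r * x + (s + n * (pi / 2)))"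
        by (simp only: sin_add) simp
      finally show "((\<lambda>x. r ^ n * sin (r * x + (s + n * (pi / 2)))) has_real_derivative
          r ^ Suc n * sin (r * x + (s + Suc n * (pi / 2)))) (at x)"
        by (auto intro!: derivative_eq_intros)
    qed
    with Suc show ?case by auto
  qed simp
  then show ?thesis by (auto simp: smooth_def real_differentiable_def intro!: exI derivative_eq_intros)
qed

lemma smooth_sin: "smooth (\<lambda>x. sin (r * x))"
  using smooth_sin_affine[of r 0] by simp

lemma smooth_cos: "smooth (\<lambda>x. cos (r * x))"
  using smooth_sin_affine[of r "pi / 2"] by (simp add: sin_add)

lemma smooth_integrable:
  assumes "smooth f"
  shows "f integrable_on {a..b}"
proof (rule integrable_continuous_real, rule differentiable_imp_continuous_on)
  have "f differentiable at x" for x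
    using assms[unfolded smooth_def, rule_format, of 0] by simp
  then show "f differentiable_on {a..b}"
    by (simp add: differentiable_on_def differentiable_at_withinI)
qed

lemma Chat_add:
  assumes "u \<in> Chat" "v \<in> Chat"
  shows "(\<lambda>x. u x + v x) \<in> Chat"
  using assms by (auto simp: Chat_def smooth_add integral_add smooth_integrable)

lemma Chat_cmult:
  assumes "u \<in> Chat"
  shows "(\<lambda>x. c * u x) \<in> Chat"
  using assms by (auto simp: Chat_def smooth_cmult)

section \<open>Real trigonometric modes on the circle\<close>

definition cos_mode :: "nat \<Rightarrow> real \<Rightarrow> real" where
  "cos_mode k x = cos (2 * pi * k * x)"

definition sin_mode :: "nat \<Rightarrow> real \<Rightarrow> real" where
  "sin_mode k x = sin (2 * pi * k * x)"

lemma sin_add_2pi_nat: "sin (x + 2 * pi * real k) = sin x"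
  using sin.plus_of_nat[of x k] by (simp add: mult_ac)

lemma cos_add_2pi_nat: "cos (x + 2 * pi * real k) = cos x"
  using cos.plus_of_nat[of x k] by (simp add: mult_ac)

lemma sin_mode_DERIV:
  "(sin_mode k has_real_derivative 2 * pi * k * cos_mode k x) (at x within S)"
  unfolding sin_mode_def[abs_def] cos_mode_def by (auto intro!: derivative_eq_intros)

lemma cos_mode_DERIV:
  "(cos_mode k has_real_derivative - (2 * pi * k * sin_mode k x)) (at x within S)"
  unfolding sin_mode_def cos_mode_def[abs_def] by (auto intro!: derivative_eq_intros)

lemma sin_mode_in_Chat:
  assumes "k \<noteq> 0"
  shows "sin_mode k \<in> Chat"
proof -
  have "(sin_mode k has_integral
      - cos_mode k 1 / (2 * pi * k) - - cos_mode k 0 / (2 * pi * k)) {0..1}"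
    using assms
    by (intro fundamental_theorem_of_calculus)
       (auto intro!: derivative_eq_intros cos_mode_DERIV
         simp flip: has_real_derivative_iff_has_vector_derivative)
  moreover have "cos_mode k 1 = cos_mode k 0"
    using cos_add_2pi_nat[of 0 k] by (simp add: cos_mode_def)
  ultimately have "integral {0..1} (sin_mode k) = 0" by (simp add: integral_unique)
  moreover have "sin_mode k (x + 1) = sin_mode k x" for x
    using sin_add_2pi_nat[of "2 * pi * k * x" k] by (simp add: sin_mode_def algebra_simps)
  ultimately show ?thesis
    using smooth_sin by (simp add: Chat_def sin_mode_def[abs_def])
qed

lemma cos_mode_in_Chat:
  assumes "k \<noteq> 0"
  shows "cos_mode k \<in> Chat"
proof -
  have "(cos_mode k has_integral
      sin_mode k 1 / (2 * pi * k) - sin_mode k 0 / (2 * pi * k)) {0..1}"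
    using assms
    by (intro fundamental_theorem_of_calculus)
       (auto intro!: derivative_eq_intros sin_mode_DERIV
         simp flip: has_real_derivative_iff_has_vector_derivative)
  moreover have "sin_mode k 1 = sin_mode k 0"
    using sin_add_2pi_nat[of 0 k] by (simp add: sin_mode_def)
  ultimately have "integral {0..1} (cos_mode k) = 0" by (simp add: integral_unique)
  moreover have "cos_mode k (x + 1) = cos_mode k x" for x
    using cos_add_2pi_nat[of "2 * pi * k * x" k] by (simp add: cos_mode_def algebra_simps)
  ultimately show ?thesis
    using smooth_cos by (simp add: Chat_def cos_mode_def[abs_def])
qed

section \<open>The real symbol of an inertia operator of Fourier type\<close>

lemma regular_inertia_operator_inj_on:
  assumes "regular_inertia_operator A"
  shows "inj_on A Chat"
  using assms homeomorphic_imp_injective_map[of Chat_topology Chat_topology A]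
  by (simp add: regular_inertia_operator_def topspace_Chat_topology)

text \<open>A complex eigenvalue \<open>p + iq\<close> acts on the pair \<open>cos_mode k\<close>,
  \<open>sin_mode k\<close> as a scaling combined with a rotation. Symmetry excludes the rotation,
  and injectivity excludes \<open>p = 0\<close>.\<close>

lemma fourier_type_real_symbol:
  assumes A: "regular_inertia_operator A" and F: "fourier_type A" and k: "k \<noteq> 0"
  obtains p where "p \<noteq> 0"
    "A (cos_mode k) = (\<lambda>x. p * cos_mode k x)" "A (sin_mode k) = (\<lambda>x. p * sin_mode k x)"
proof -
  have "int k \<noteq> 0" using k by simp
  with F obtain \<beta> where
    \<beta>: "complexified A (fourier_mode (int k)) = (\<lambda>x. \<beta> * fourier_mode (int k) x)"
    unfolding fourier_type_def by blast
  define p where "p = Re \<beta>"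
  define q where "q = Im \<beta>"
  have mode: "fourier_mode (int k) x = Complex (cos_mode k x) (sin_mode k x)" for x
    by (simp add: fourier_mode_def complex_eq_iff cos_mode_def sin_mode_def Re_exp Im_exp)
  have "of_real (A (cos_mode k) x) + \<i> * of_real (A (sin_mode k) x)
      = \<beta> * Complex (cos_mode k x) (sin_mode k x)" for x
    using fun_cong[OF \<beta>, of x] by (simp add: complexified_def mode)
  then have C: "A (cos_mode k) x = p * cos_mode k x - q * sin_mode k x"
    and S: "A (sin_mode k) x = p * sin_mode k x + q * cos_mode k x" for x
    by (simp_all add: complex_eq_iff p_def q_def)
  have cS: "sin_mode k \<in> Chat" and cC: "cos_mode k \<in> Chat"
    using k by (auto intro: sin_mode_in_Chat cos_mode_in_Chat)
  \<comment> \<open>Stated with free coefficients so as to cover both integrands when the integral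
    of their difference is formed below.\<close>
  have int: "(\<lambda>x. (a * cos_mode k x + b * sin_mode k x) * (c * cos_mode k x + e * sin_mode k x))
      integrable_on {0..1}" for a b c e
    unfolding sin_mode_def cos_mode_def
    by (intro integrable_continuous_real continuous_intros)
  have "integral {0..1} (\<lambda>x. A (cos_mode k) x * sin_mode k x)
      = integral {0..1} (\<lambda>x. cos_mode k x * A (sin_mode k) x)"
    using A cS cC by (auto simp: regular_inertia_operator_def L2_symmetric_def)
  then have "0 = integral {0..1} (\<lambda>x. cos_mode k x * A (sin_mode k) x)
      - integral {0..1} (\<lambda>x. A (cos_mode k) x * sin_mode k x)" by simp
  also have "\<dots> = integral {0..1} (\<lambda>x. cos_mode k x * A (sin_mode k) x
      - A (cos_mode k) x * sin_mode k x)"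
    using int[of 1 0 q p] int[of p "-q" 0 1]
    by (intro Henstock_Kurzweil_Integration.integral_diff[symmetric])
       (simp_all add: C S algebra_simps)
  \<comment> \<open>The terms in \<open>p\<close> cancel. What remains measures the failure of
    symmetry and is the constant \<open>q\<close>.\<close>
  also have "\<dots> = integral {0..1} (\<lambda>x::real. q * ((cos_mode k x)\<^sup>2 + (sin_mode k x)\<^sup>2))"
    by (simp add: C S algebra_simps power2_eq_square)
  also have "\<dots> = q"
    by (simp add: cos_mode_def sin_mode_def)
  finally have "q = 0" by simp
  with C S have AC: "A (cos_mode k) = (\<lambda>x. p * cos_mode k x)"
    and AS: "A (sin_mode k) = (\<lambda>x. p * sin_mode k x)" by auto
  have "p \<noteq> 0"
  proof
    assume "p = 0"
    \<comment> \<open>Writing the zero function as a multiple of \<open>cos_mode k\<close> makes it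
      accessible to homogeneity and \<open>Chat_cmult\<close>. It would share its image with
      \<open>cos_mode k\<close>.\<close>
    have "A (\<lambda>x. 0 * cos_mode k x) = (\<lambda>x. 0 * A (cos_mode k) x)"
      using A cC unfolding regular_inertia_operator_def linear_on_Chat_def by blast
    then have "A (\<lambda>x. 0 * cos_mode k x) = A (cos_mode k)"
      using AC \<open>p = 0\<close> by simp
    then have "(\<lambda>x. 0 * cos_mode k x) = cos_mode k"
      using regular_inertia_operator_inj_on[OF A] Chat_cmult[OF cC] cC by (meson inj_onD)
    then show False
      by (auto simp: cos_mode_def dest!: fun_cong[of _ _ 0])
  qed
  then show thesis using AC AS by (rule that)
qed

section \<open>Sine polynomials of degree four, which contain all brackets of the test
  function\<close>

definition sin_poly :: "real \<Rightarrow> real \<Rightarrow> real \<Rightarrow> real \<Rightarrow> real \<Rightarrow> real" where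
  "sin_poly a b c e x = a * sin_mode 1 x + (b * sin_mode 2 x + (c * sin_mode 3 x + e * sin_mode 4 x))"

lemma sin_poly_in_Chat: "sin_poly a b c e \<in> Chat"
  unfolding sin_poly_def[abs_def] by (intro Chat_add Chat_cmult sin_mode_in_Chat) auto

lemma neg_dxx_sin_poly:
  "neg_dxx (sin_poly a b c e) = sin_poly (4*pi\<^sup>2*a) (16*pi\<^sup>2*b) (36*pi\<^sup>2*c) (64*pi\<^sup>2*e)"
proof -
  have 1: "deriv (sin_poly a b c e) = (\<lambda>x. 2 * pi * (a * cos_mode 1 x + 2 * b * cos_mode 2 x
      + 3 * c * cos_mode 3 x + 4 * e * cos_mode 4 x))"
    unfolding sin_poly_def[abs_def]
    by (intro ext DERIV_imp_deriv)
       (auto intro!: derivative_eq_intros sin_mode_DERIV simp: algebra_simps)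
  show ?thesis
    unfolding neg_dxx_def 1
    by (intro ext, subst DERIV_imp_deriv)
       (auto intro!: derivative_eq_intros cos_mode_DERIV
         simp: sin_poly_def algebra_simps power2_eq_square)
qed

text \<open>Sampling replaces Fourier integrals. Mode 4 vanishes at 1/8, 1/4 and 3/8. The point 1/4
  gives \<open>a - c\<close>; adding the values at 1/8 and 3/8 removes mode 2 and gives
  \<open>a + c\<close> up to the factor \<open>2 * s\<close>.\<close>

lemma sin_poly_eqD:
  assumes "sin_poly a b c e = sin_poly a' b' c' e'"
  shows "a = a'"
proof -
  define s where "s = sqrt 2 / 2"
  have s: "s > 0" by (simp add: s_def)
  have vals: "sin (pi / 4) = s" "sin (3 * pi / 4) = s" "sin (pi / 2) = 1" "sin (3 * pi / 2) = -1"
      "sin (9 * pi / 4) = s" "sin (3*pi) = 0"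
    using sin_add[of "pi/2" "pi/4"] sin_add[of "pi" "pi/2"] sin_add[of "2*pi" "pi/4"] sin_npi[of 3]
    by (simp_all add: s_def sin_45 cos_45)
  have "a - c = a' - c'"
    using fun_cong[OF assms, of "1/4"] vals by (simp add: sin_poly_def sin_mode_def)
  moreover have "(a + c) * s + b = (a' + c') * s + b'"
    using fun_cong[OF assms, of "1/8"] vals by (simp add: sin_poly_def sin_mode_def algebra_simps)
  moreover have "(a + c) * s - b = (a' + c') * s - b'"
    using fun_cong[OF assms, of "3/8"] vals by (simp add: sin_poly_def sin_mode_def algebra_simps)
  ultimately have "a - c = a' - c'" "(a + c) * s = (a' + c') * s" by linarith+
  then show ?thesis using s by simp
qed

text \<open>The free \<open>c\<close> lets one computation serve both equations:
  \<open>c = 2\<close> with the symbol of \<open>A\<close> as \<open>p\<close>, \<open>q\<close>,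
  and \<open>c = (d - 3) / (d - 1)\<close> with the symbol of \<open>neg_dxx\<close>. Cross terms of
  modes 1 and 2 produce modes 1 and 3, diagonal terms modes 2 and 4. At \<open>c = 2\<close> the
  mode 1 coefficient is \<open>- 3 * pi * p\<close>, free of \<open>q\<close>.\<close>

lemma bracket_cos_modes:
  fixes c p q x :: real
  shows "c * (p * cos_mode 1 x + q * cos_mode 2 x) * deriv (\<lambda>x. cos_mode 1 x + cos_mode 2 x) x
      + (cos_mode 1 x + cos_mode 2 x) * deriv (\<lambda>x. p * cos_mode 1 x + q * cos_mode 2 x) x
    = sin_poly (- pi * (2*c*p + 2*q - c*q - p)) (- pi * (c + 1) * p)
        (- pi * (2*c*p + 2*q + c*q + p)) (- 2 * pi * (c + 1) * q) x"
proof -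
  have 1: "deriv (\<lambda>x. p * cos_mode 1 x + q * cos_mode 2 x) x
      = - (2 * pi) * (p * sin_mode 1 x + 2 * q * sin_mode 2 x)" for p q
    by (intro DERIV_imp_deriv)
       (auto intro!: derivative_eq_intros cos_mode_DERIV simp: algebra_simps)
  have m2: "sin_mode 2 x = 2 * (cos_mode 1 x * sin_mode 1 x)"
    using sin_double[of "2*pi*x"] by (simp add: sin_mode_def cos_mode_def algebra_simps)
  have m4: "sin_mode 4 x = 2 * (cos_mode 2 x * sin_mode 2 x)"
    using sin_double[of "4*pi*x"] by (simp add: sin_mode_def cos_mode_def algebra_simps)
  have m3: "sin_mode 3 x = sin_mode 2 x * cos_mode 1 x + cos_mode 2 x * sin_mode 1 x"
    using sin_add[of "4*pi*x" "2*pi*x"] by (simp add: sin_mode_def cos_mode_def algebra_simps)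
  have m1: "sin_mode 1 x = sin_mode 2 x * cos_mode 1 x - cos_mode 2 x * sin_mode 1 x"
    using sin_diff[of "4*pi*x" "2*pi*x"] by (simp add: sin_mode_def cos_mode_def algebra_simps)
  \<comment> \<open>Once all sines are expressed through the values of modes 1 and 2, the claim is a
    polynomial identity.\<close>
  have id: "c * (p * C1 + q * C2) * (- (2 * pi) * (S1 + 2 * S2))
      + (C1 + C2) * (- (2 * pi) * (p * S1 + 2 * q * S2))
    = (- pi * (2*c*p + 2*q - c*q - p)) * (S2 * C1 - C2 * S1)
      + ((- pi * (c + 1) * p) * (2 * (C1 * S1))
      + ((- pi * (2*c*p + 2*q + c*q + p)) * (S2 * C1 + C2 * S1)
      + (- 2 * pi * (c + 1) * q) * (2 * (C2 * S2))))" for C1 C2 S1 S2 :: real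
    by algebra
  have 2: "deriv (\<lambda>x. cos_mode 1 x + cos_mode 2 x) x
      = - (2 * pi) * (sin_mode 1 x + 2 * sin_mode 2 x)"
    using 1[of 1 1] by simp
  show ?thesis
    unfolding 1 2 sin_poly_def id m1[symmetric] m2[symmetric] m3[symmetric] m4[symmetric] ..
qed

section \<open>Comparison of the two flows at the test function\<close>

theorem corollary3p5:
  fixes d :: nat
  assumes "d \<ge> 2"
  shows "\<not> (\<exists>A. regular_inertia_operator A \<and> fourier_type A \<and>
                realized_as_euler (axisymmetric_rhs d) A)"
proof
  assume "\<exists>A. regular_inertia_operator A \<and> fourier_type A \<and>
                realized_as_euler (axisymmetric_rhs d) A"
  then obtain A where A: "regular_inertia_operator A" and F: "fourier_type A"
    and R: "realized_as_euler (axisymmetric_rhs d) A" by blast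
  define c where "c = (real d - 3) / (real d - 1)"
  define u where "u = (\<lambda>x. cos_mode 1 x + cos_mode 2 x)"
  have lin: "linear_on_Chat A" using A by (simp add: regular_inertia_operator_def)
  have add: "A (\<lambda>x. f x + g x) = (\<lambda>x. A f x + A g x)" if "f \<in> Chat" "g \<in> Chat" for f g
    using lin that by (simp add: linear_on_Chat_def)
  have scale: "A (\<lambda>x. r * f x) = (\<lambda>x. r * A f x)" if "f \<in> Chat" for f r
    using lin that by (simp add: linear_on_Chat_def)
  have "\<exists>p. p \<noteq> 0 \<and> A (cos_mode k) = (\<lambda>x. p * cos_mode k x) \<and>
      A (sin_mode k) = (\<lambda>x. p * sin_mode k x)" if "k \<noteq> 0" for k
    using fourier_type_real_symbol[OF A F that] by metis
  then obtain p where p: "p k \<noteq> 0" "A (cos_mode k) = (\<lambda>x. p k * cos_mode k x)"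
      "A (sin_mode k) = (\<lambda>x. p k * sin_mode k x)" if "k \<noteq> 0" for k
    by metis
  have u: "u \<in> Chat"
    unfolding u_def by (intro Chat_add cos_mode_in_Chat) auto
  have Au: "A u = (\<lambda>x. p 1 * cos_mode 1 x + p 2 * cos_mode 2 x)"
    by (simp add: u_def add cos_mode_in_Chat p)
  have A_sin_poly: "A (sin_poly a b e f) = sin_poly (p 1 * a) (p 2 * b) (p 3 * e) (p 4 * f)"
    for a b e f
    by (simp add: sin_poly_def[abs_def] add scale Chat_add Chat_cmult sin_mode_in_Chat p mult_ac)
  \<comment> \<open>The preimage under \<open>A\<close> of the Euler bracket: its coefficients at
    \<open>c = 2\<close>, divided by the symbol mode by mode. In mode 1 the factor
    \<open>p 1\<close> cancels, so that coefficient is independent of \<open>A\<close>.\<close>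
  define z where "z = sin_poly (- 3 * pi) (- 3 * pi * p 1 / p 2)
      (- pi * (5 * p 1 + 4 * p 2) / p 3) (- 6 * pi * p 2 / p 4)"
  have Az: "A z = sin_poly (- 3 * pi * p 1) (- 3 * pi * p 1)
      (- pi * (5 * p 1 + 4 * p 2)) (- 6 * pi * p 2)"
    unfolding z_def A_sin_poly by (simp add: p mult_ac)
  have "(\<lambda>y. 2 * A u y * deriv u y + u y * deriv (A u) y) = A z"
    unfolding Az Au unfolding u_def bracket_cos_modes
    by (rule ext) (simp add: algebra_simps)
  moreover have "inv_into Chat A (A z) = z"
    unfolding z_def by (rule inv_into_f_f[OF regular_inertia_operator_inj_on[OF A] sin_poly_in_Chat])
  ultimately have euler: "euler_rhs A u = (\<lambda>x. - z x)"
    unfolding euler_rhs_def by (simp only:)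
  have neg_u: "neg_dxx u = (\<lambda>x. 4*pi\<^sup>2 * cos_mode 1 x + 16*pi\<^sup>2 * cos_mode 2 x)"
  proof -
    have 1: "deriv u = (\<lambda>x. - (2 * pi) * (sin_mode 1 x + 2 * sin_mode 2 x))"
      unfolding u_def
      by (intro ext DERIV_imp_deriv)
         (auto intro!: derivative_eq_intros cos_mode_DERIV simp: algebra_simps)
    show ?thesis
      unfolding neg_dxx_def 1
      by (intro ext, subst DERIV_imp_deriv)
         (auto intro!: derivative_eq_intros sin_mode_DERIV simp: algebra_simps power2_eq_square)
  qed
  define B where "B = (\<lambda>y. c * neg_dxx u y * deriv u y + u y * deriv (neg_dxx u) y)"
  \<comment> \<open>Only mode 1 will be compared, so the other coefficients stay anonymous. The
    symbol value \<open>4 * pi\<^sup>2\<close> is factored out in preparation for inverting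
    \<open>neg_dxx\<close>.\<close>
  obtain b2 b3 b4 where B: "B = sin_poly (4 * pi\<^sup>2 * (- pi * (7 - 2 * c))) b2 b3 b4"
  proof
    show "B = sin_poly (4 * pi\<^sup>2 * (- pi * (7 - 2 * c))) (- pi * (c + 1) * (4*pi\<^sup>2))
        (- pi * (2*c*(4*pi\<^sup>2) + 2*(16*pi\<^sup>2) + c*(16*pi\<^sup>2) + 4*pi\<^sup>2)) (- 2 * pi * (c + 1) * (16*pi\<^sup>2))"
      unfolding B_def neg_u unfolding u_def bracket_cos_modes
      by (rule ext) (simp add: algebra_simps)
  qed
  \<comment> \<open>An explicit preimage in \<open>Chat\<close> ensures that \<open>neg_dxx\<close>
    undoes \<open>inv_into Chat neg_dxx\<close> at \<open>B\<close>; the comparison can then take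
    place after applying \<open>neg_dxx\<close>.\<close>
  have "B = neg_dxx (sin_poly (- pi * (7 - 2 * c)) (b2 / (16*pi\<^sup>2)) (b3 / (36*pi\<^sup>2)) (b4 / (64*pi\<^sup>2)))"
    unfolding neg_dxx_sin_poly B by simp
  then have "B \<in> neg_dxx ` Chat" using sin_poly_in_Chat by blast
  then have "neg_dxx (inv_into Chat neg_dxx B) = B" by (rule f_inv_into_f)
  moreover have "inv_into Chat neg_dxx B = z"
  proof
    fix x
    have "axisymmetric_rhs d u x = euler_rhs A u x"
      using R u by (simp add: realized_as_euler_def)
    then show "inv_into Chat neg_dxx B x = z x"
      by (simp add: euler axisymmetric_rhs_def B_def c_def)
  qed
  ultimately have "neg_dxx z = B" by simp
  then have "4 * pi\<^sup>2 * (- 3 * pi) = 4 * pi\<^sup>2 * (- pi * (7 - 2 * c))"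
    unfolding z_def neg_dxx_sin_poly B by (rule sin_poly_eqD)
  then have "c = 2" by simp
  \<comment> \<open>Clearing denominators in \<open>c = 2\<close> would give
    \<open>d = -1\<close>.\<close>
  then show False using assms by (simp add: c_def field_simps)
qed

end
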